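(* Let $\lambda,\mu\in\mathbb{C}^*$ and $\alpha,\beta\in\mathbb{C}$. Then $\Omega_{\mathcal{NS}}(\lambda,\alpha)\cong\Omega_{\mathcal{NS}}(\mu,\beta)$ as $\mathcal{NS}$-modules if and only if $\lambda=\mu$ and $\alpha=\beta$.
   Context: All spaces are over $\mathbb{C}$; $\mathbb{C}^*$ is the set of nonzero complex numbers. The Neveu-Schwarz algebra $\mathcal{NS}$ is the Lie superalgebra whose even part has basis $\{L_n\mid n\in\mathbb{Z}\}$ and whose odd part has basis $\{G_r\mid r\in\frac12+\mathbb{Z}\}$, with brackets $[L_m,L_n]=(m-n)L_{m+n}$, $[L_m,G_r]=(\frac m2-r)G_{m+r}$, $[G_r,G_s]=2L_{r+s}$. A module over a Lie superalgebra $A$ always means a supermodule $M=M_{\bar 0}\oplus M_{\bar 1}$ with $A_{\bar i}\cdot M_{\bar j}\subseteq M_{\bar i+\bar j}$; $\cong$ denotes (parity-preserving) isomorphism of supermodules. For $\lambda\in\mathbb{C}^*$, $\alpha\in\mathbb{C}$, $\Omega_{\mathcal{NS}}(\lambda,\alpha)$ is the $\mathcal{NS}$-module with underlying space $\mathbb{C}[x]\oplus\mathbb{C}[y]$ (part $\bar 0$ is $\mathbb{C}[x]$, part $\bar 1$ is $\mathbb{C}[y]$) and action, for $m\in\mathbb{Z}$, $r\in\frac12+\mathbb{Z}$, $f(x)\in\mathbb{C}[x]$, $g(y)\in\mathbb{C}[y]$: $L_mf(x)=\lambda^m(x+m\alpha)f(x+m)$, $L_mg(y)=\lambda^m(y+m(\alpha+\frac12))g(y+m)$,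 $G_rf(x)=\lambda^{r-\frac12}f(y+r)$, $G_rg(y)=\lambda^{r+\frac12}(x+2r\alpha)g(x+r)$. *)

theory Defs
  imports
    Complex_Main
    "HOL-Library.Z2"
    "HOL-Library.Poly_Mapping"
    "HOL-Library.Product_Plus"
    "HOL-Computational_Algebra.Polynomial"
begin

section \<open>Super vector spaces, Lie superalgebras and supermodules over the complex numbers\<close>

text \<open>The underlying space is always a whole type; \<open>part V i\<close> is its homogeneous part of parity
  \<open>i\<close>, an element of the two-element field.\<close>

record 'v super_data =
  scale :: "complex \<Rightarrow> 'v \<Rightarrow> 'v"
  part :: "bit \<Rightarrow> 'v set"

record 'a superalgebra_data = "'a super_data" +
  bracket :: "'a \<Rightarrow> 'a \<Rightarrow> 'a"

record ('a, 'v) supermodule_data = "'v super_data" +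
  act :: "'a \<Rightarrow> 'v \<Rightarrow> 'v"

definition super_vector_space :: "('v::ab_group_add, 'z) super_data_scheme \<Rightarrow> bool" where
  "super_vector_space V \<longleftrightarrow>
     vector_space (scale V) \<and>
     (\<forall>i. module.subspace (scale V) (part V i)) \<and>
     part V 0 \<inter> part V 1 = {0} \<and>
     (\<forall>v. \<exists>u\<in>part V 0. \<exists>w\<in>part V 1. v = u + w)"

definition koszul_sign :: "bit \<Rightarrow> bit \<Rightarrow> complex" where
  "koszul_sign i j = (if i = 1 \<and> j = 1 then -1 else 1)"

definition lie_superalgebra :: "'a::ab_group_add superalgebra_data \<Rightarrow> bool" where
  "lie_superalgebra A \<longleftrightarrow>
     super_vector_space A \<and>
     (\<forall>x. Vector_Spaces.linear (scale A) (scale A) (\<lambda>y. bracket A x y)) \<and>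
     (\<forall>y. Vector_Spaces.linear (scale A) (scale A) (\<lambda>x. bracket A x y)) \<and>
     (\<forall>i j. \<forall>x\<in>part A i. \<forall>y\<in>part A j. bracket A x y \<in> part A (i + j)) \<and>
     (\<forall>i j. \<forall>x\<in>part A i. \<forall>y\<in>part A j.
        bracket A x y = - scale A (koszul_sign i j) (bracket A y x)) \<and>
     (\<forall>i j. \<forall>x\<in>part A i. \<forall>y\<in>part A j. \<forall>z.
        bracket A x (bracket A y z) =
          bracket A (bracket A x y) z + scale A (koszul_sign i j) (bracket A y (bracket A x z)))"

definition supermodule ::
  "'a::ab_group_add superalgebra_data \<Rightarrow> ('a, 'v::ab_group_add) supermodule_data \<Rightarrow> bool" where
  "supermodule A M \<longleftrightarrow>
     lie_superalgebra A \<and>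
     super_vector_space M \<and>
     (\<forall>x. Vector_Spaces.linear (scale M) (scale M) (\<lambda>v. act M x v)) \<and>
     (\<forall>v. Vector_Spaces.linear (scale A) (scale M) (\<lambda>x. act M x v)) \<and>
     (\<forall>i j. \<forall>x\<in>part A i. \<forall>v\<in>part M j. act M x v \<in> part M (i + j)) \<and>
     (\<forall>i j. \<forall>x\<in>part A i. \<forall>y\<in>part A j. \<forall>v.
        act M (bracket A x y) v =
          act M x (act M y v) - scale M (koszul_sign i j) (act M y (act M x v)))"

definition supermodule_isomorphism ::
  "('a, 'v::ab_group_add) supermodule_data \<Rightarrow> ('a, 'w::ab_group_add) supermodule_data
     \<Rightarrow> ('v \<Rightarrow> 'w) \<Rightarrow> bool" where
  "supermodule_isomorphism M N \<phi> \<longleftrightarrow>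
     Vector_Spaces.linear (scale M) (scale N) \<phi> \<and>
     bij \<phi> \<and>
     (\<forall>i. \<phi> ` part M i \<subseteq> part N i) \<and>
     (\<forall>x v. \<phi> (act M x v) = act N x (\<phi> v))"

definition supermodule_isomorphic ::
  "'a::ab_group_add superalgebra_data \<Rightarrow> ('a, 'v::ab_group_add) supermodule_data
     \<Rightarrow> ('a, 'w::ab_group_add) supermodule_data \<Rightarrow> bool" where
  "supermodule_isomorphic A M N \<longleftrightarrow>
     supermodule A M \<and> supermodule A N \<and> (\<exists>\<phi>. supermodule_isomorphism M N \<phi>)"


section \<open>The Neveu-Schwarz algebra\<close>

text \<open>\<open>G k\<close> stands for the odd basis element \<open>G\<^sub>r\<close> with \<open>r = k + 1/2\<close>; \<open>half k\<close> is that index \<open>r\<close>.\<close>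

datatype ns_basis = L int | G int

definition half :: "int \<Rightarrow> complex" where
  "half k = of_int k + 1/2"

fun ns_parity :: "ns_basis \<Rightarrow> bit" where
  "ns_parity (L m) = 0"
| "ns_parity (G k) = 1"

type_synonym ns = "ns_basis \<Rightarrow>\<^sub>0 complex"

definition ns_scale :: "complex \<Rightarrow> ns \<Rightarrow> ns" where
  "ns_scale c a = Poly_Mapping.map ((*) c) a"

text \<open>The value at \<open>a\<close> of the linear extension of a map \<open>f\<close> given on the basis.\<close>

definition ns_extend :: "(complex \<Rightarrow> 'v \<Rightarrow> 'v::ab_group_add) \<Rightarrow> (ns_basis \<Rightarrow> 'v) \<Rightarrow> ns \<Rightarrow> 'v" where
  "ns_extend s f a = (\<Sum>b\<in>Poly_Mapping.keys a. s (Poly_Mapping.lookup a b) (f b))"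

text \<open>In the last equation \<open>r + s = (k + 1/2) + (l + 1/2) = k + l + 1\<close>; the third one is forced by
  super skew-symmetry.\<close>

fun ns_basis_bracket :: "ns_basis \<Rightarrow> ns_basis \<Rightarrow> ns" where
  "ns_basis_bracket (L m) (L n) = Poly_Mapping.single (L (m + n)) (of_int (m - n))"
| "ns_basis_bracket (L m) (G k) = Poly_Mapping.single (G (m + k)) (of_int m / 2 - half k)"
| "ns_basis_bracket (G k) (L m) = Poly_Mapping.single (G (m + k)) (- (of_int m / 2 - half k))"
| "ns_basis_bracket (G k) (G l) = Poly_Mapping.single (L (k + l + 1)) 2"

definition NS :: "ns superalgebra_data" where
  "NS = \<lparr>scale = ns_scale,
         part = (\<lambda>i. {a. \<forall>b\<in>Poly_Mapping.keys a. ns_parity b = i}),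
         bracket = (\<lambda>x y. ns_extend ns_scale
                      (\<lambda>b. ns_extend ns_scale (\<lambda>c. ns_basis_bracket b c) y) x)\<rparr>"


section \<open>The modules \<open>\<Omega>\<close>\<close>

definition shift :: "complex \<Rightarrow> complex poly \<Rightarrow> complex poly" where
  "shift c f = pcompose f [:c, 1:]"

text \<open>A pair \<open>(f, g)\<close> stands for \<open>f(x) + g(y)\<close>.  With \<open>r = k + 1/2\<close> the exponents \<open>r - 1/2\<close> and
  \<open>r + 1/2\<close> are the integers \<open>k\<close> and \<open>k + 1\<close>.\<close>

fun Omega_basis_act ::
  "complex \<Rightarrow> complex \<Rightarrow> ns_basis \<Rightarrow> complex poly \<times> complex poly \<Rightarrow> complex poly \<times> complex poly" where
  "Omega_basis_act lam \<alpha> (L m) (f, g) =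
     (smult (lam powi m) ([:of_int m * \<alpha>, 1:] * shift (of_int m) f),
      smult (lam powi m) ([:of_int m * (\<alpha> + 1/2), 1:] * shift (of_int m) g))"
| "Omega_basis_act lam \<alpha> (G k) (f, g) =
     (smult (lam powi (k + 1)) ([:2 * half k * \<alpha>, 1:] * shift (half k) g),
      smult (lam powi k) (shift (half k) f))"

definition pair_scale :: "complex \<Rightarrow> complex poly \<times> complex poly \<Rightarrow> complex poly \<times> complex poly" where
  "pair_scale c = map_prod (smult c) (smult c)"

definition Omega_NS :: "complex \<Rightarrow> complex \<Rightarrow> (ns, complex poly \<times> complex poly) supermodule_data" where
  "Omega_NS lam \<alpha> =
     \<lparr>scale = pair_scale,
      part = (\<lambda>i. if i = 0 then {v. snd v = 0} else {v. fst v = 0}),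
      act = (\<lambda>a v. ns_extend pair_scale (\<lambda>b. Omega_basis_act lam \<alpha> b v) a)\<rparr>"


section \<open>The Neveu-Schwarz algebra is a Lie superalgebra\<close>


lemma lookup_ns_scale [simp]: "Poly_Mapping.lookup (ns_scale c a) b = c * Poly_Mapping.lookup a b"
  by (simp add: ns_scale_def Poly_Mapping.map.rep_eq when_def)

lemma ns_scale_single [simp]: "ns_scale c (Poly_Mapping.single b d) = Poly_Mapping.single b (c * d)"
  by (rule poly_mapping_eqI) (simp add: lookup_single when_def)

lemma vector_space_ns: "vector_space ns_scale"
  by unfold_locales (auto intro!: poly_mapping_eqI simp: lookup_add algebra_simps)

interpretation nsv: vector_space ns_scale by (rule vector_space_ns)

lemma vector_space_pair: "vector_space pair_scale"
  by unfold_locales (auto simp: pair_scale_def map_prod_def smult_add_right smult_add_left split_beta)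

lemma ns_extend_superset:
  assumes "vector_space s" "finite B" "Poly_Mapping.keys a \<subseteq> B"
  shows "ns_extend s f a = (\<Sum>b\<in>B. s (Poly_Mapping.lookup a b) (f b))"
proof -
  interpret vector_space s by fact
  show ?thesis unfolding ns_extend_def
    by (rule sum.mono_neutral_left) (use assms in \<open>auto simp: in_keys_iff\<close>)
qed

lemma ns_extend_single [simp]:
  assumes "vector_space s"
  shows "ns_extend s f (Poly_Mapping.single b c) = s c (f b)"
  by (subst ns_extend_superset[where B = "{b}"]) (use assms in auto)

lemma linear_ns_extend:
  assumes "vector_space s"
  shows "Vector_Spaces.linear ns_scale s (ns_extend s f)"
proof -
  interpret vector_space s by fact
  have "ns_extend s f (x + y) = ns_extend s f x + ns_extend s f y" for x y
  proof -
    let ?B = "Poly_Mapping.keys x \<union> Poly_Mapping.keys y"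
    have "Poly_Mapping.keys (x + y) \<subseteq> ?B" by (rule Poly_Mapping.keys_add)
    then show ?thesis
      by (simp add: ns_extend_superset[OF assms, of ?B] lookup_add scale_left_distrib sum.distrib)
  qed
  moreover have "ns_extend s f (ns_scale c x) = s c (ns_extend s f x)" for c x
  proof -
    have "Poly_Mapping.keys (ns_scale c x) \<subseteq> Poly_Mapping.keys x"
      by (auto simp: in_keys_iff)
    then show ?thesis
      by (simp add: ns_extend_superset[OF assms, of "Poly_Mapping.keys x"] scale_sum_right)
  qed
  ultimately show ?thesis
    unfolding Vector_Spaces.linear_iff using assms vector_space_ns by blast
qed

lemma linear_ns_extend_coeff:
  assumes "vector_space s" and "vector_space t"
    and "\<And>b. Vector_Spaces.linear t s (\<lambda>v. f b v)"
  shows "Vector_Spaces.linear t s (\<lambda>v. ns_extend s (\<lambda>b. f b v) a)"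
proof -
  interpret vector_space s by fact
  have add: "f b (x + y) = f b x + f b y" and sc: "f b (t c x) = s c (f b x)" for b c x y
    using assms(3) unfolding Vector_Spaces.linear_iff by auto
  show ?thesis unfolding Vector_Spaces.linear_iff ns_extend_def
    using assms(1,2)
    by (auto simp: add sc scale_right_distrib sum.distrib scale_sum_right mult.commute)
qed

lemma ns_induct [consumes 1, case_names zero add scale single]:
  assumes "\<forall>b\<in>Poly_Mapping.keys a. Q b"
    and "P 0" and "\<And>x y. P x \<Longrightarrow> P y \<Longrightarrow> P (x + y)" and "\<And>c x. P x \<Longrightarrow> P (ns_scale c x)"
    and "\<And>b. Q b \<Longrightarrow> P (Poly_Mapping.single b 1)"
  shows "P a"
  using assms(1)
proof (induction a rule: Poly_Mapping.update_induct)
  case (update f b c)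
  have eq: "Poly_Mapping.update b c f = ns_scale c (Poly_Mapping.single b 1) + f"
    using update(1) by (intro poly_mapping_eqI)
      (auto simp: lookup_update lookup_add lookup_single when_def in_keys_iff)
  have "Poly_Mapping.keys (Poly_Mapping.update b c f) = insert b (Poly_Mapping.keys f)"
    using update(1,2) by (auto simp: in_keys_iff lookup_update split: if_splits)
  then have "Q b" and "P f" using update by auto
  then show ?case unfolding eq by (intro assms)
qed (rule assms)

lemmas ns_induct_UNIV [case_names zero add scale single] =
  ns_induct[where Q = "\<lambda>_. True", simplified]

lemma NS_simps [simp]:
  "scale NS = ns_scale"
  "a \<in> part NS i \<longleftrightarrow> (\<forall>b\<in>Poly_Mapping.keys a. ns_parity b = i)"
  by (simp_all add: NS_def)

lemma subspace_part_NS: "nsv.subspace (part NS i)"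
proof (rule nsv.subspaceI)
  fix x y assume "x \<in> part NS i" "y \<in> part NS i"
  then show "x + y \<in> part NS i"
    using Poly_Mapping.keys_add[of x y] by auto
qed (auto simp: in_keys_iff)

lemma super_vector_space_NS: "super_vector_space NS"
proof -
  have "\<exists>u\<in>part NS 0. \<exists>w\<in>part NS 1. v = u + w" for v :: ns
  proof (induction v rule: ns_induct_UNIV)
    case zero
    show ?case by (intro bexI[of _ 0]) auto
  next
    case (add x y)
    then obtain u w u' w' where "u \<in> part NS 0" "w \<in> part NS 1" "u' \<in> part NS 0" "w' \<in> part NS 1"
      "x = u + w" "y = u' + w'" by blast
    then show ?case
      by (intro bexI[of _ "u + u'"] bexI[of _ "w + w'"] nsv.subspace_add subspace_part_NS) auto
  next
    case (scale c x)
    then obtain u w where "u \<in> part NS 0" "w \<in> part NS 1" "x = u + w" by blast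
    then show ?case
      by (intro bexI[of _ "ns_scale c u"] bexI[of _ "ns_scale c w"] nsv.subspace_scale subspace_part_NS)
         (auto simp: nsv.scale_right_distrib)
  next
    case (single b)
    show ?case
    proof (cases b)
      case (L m)
      then show ?thesis by (intro bexI[of _ "Poly_Mapping.single b 1"] bexI[of _ 0]) auto
    next
      case (G m)
      then show ?thesis by (intro bexI[of _ 0] bexI[of _ "Poly_Mapping.single b 1"]) auto
    qed
  qed
  moreover have "part NS 0 \<inter> part NS 1 = {0}"
  proof -
    have "x = 0" if "x \<in> part NS 0" "x \<in> part NS 1" for x
    proof -
      have "Poly_Mapping.keys x = {}" using that by fastforce
      then show ?thesis by simp
    qed
    then show ?thesis by auto
  qed
  ultimately show ?thesis
    unfolding super_vector_space_def using vector_space_ns subspace_part_NS by simp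
qed

lemma linear_bracket:
  "Vector_Spaces.linear ns_scale ns_scale (\<lambda>y. bracket NS x y)"
  "Vector_Spaces.linear ns_scale ns_scale (\<lambda>x. bracket NS x y)"
  using linear_ns_extend_coeff[OF vector_space_ns vector_space_ns linear_ns_extend[OF vector_space_ns]]
    linear_ns_extend[OF vector_space_ns]
  by (simp_all add: NS_def)

lemma bracket_single:
  "bracket NS (Poly_Mapping.single b 1) (Poly_Mapping.single c 1) = ns_basis_bracket b c"
  by (simp add: NS_def vector_space_ns vector_space.vector_space_assms(4)[OF vector_space_ns])

lemma ns_linear_simps:
  assumes "Vector_Spaces.linear s t f"
  shows "f 0 = 0" "f (x + y) = f x + f y" "f (s c x) = t c (f x)"
  using assms module_hom.zero[OF module_hom_linearI[OF assms]] unfolding Vector_Spaces.linear_iff by auto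

lemmas bracket_simps [simp] = ns_linear_simps[OF linear_bracket(1)] ns_linear_simps[OF linear_bracket(2)]


lemma bracket_part:
  assumes "\<forall>b\<in>Poly_Mapping.keys x. ns_parity b = i" "\<forall>b\<in>Poly_Mapping.keys y. ns_parity b = j"
  shows "bracket NS x y \<in> part NS (i + j)"
  using assms(1)
proof (induction x rule: ns_induct)
  case (single b)
  from assms(2) show ?case
  proof (induction y rule: ns_induct)
    case (single c)
    with \<open>ns_parity b = i\<close> show ?case
      by (cases b; cases c) (auto simp: bracket_single split: if_splits)
  qed (auto simp del: NS_simps(2) intro!: nsv.subspace_0 nsv.subspace_add nsv.subspace_scale subspace_part_NS)
qed (auto simp del: NS_simps(2) intro!: nsv.subspace_0 nsv.subspace_add nsv.subspace_scale subspace_part_NS)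

lemma bracket_skew:
  assumes "\<forall>b\<in>Poly_Mapping.keys x. ns_parity b = i" "\<forall>b\<in>Poly_Mapping.keys y. ns_parity b = j"
  shows "bracket NS x y = - ns_scale (koszul_sign i j) (bracket NS y x)"
  using assms(1)
proof (induction x rule: ns_induct)
  case (single b)
  from assms(2) show ?case
  proof (induction y rule: ns_induct)
    case (single c)
    with \<open>ns_parity b = i\<close> show ?case
      by (cases b; cases c) (auto simp: bracket_single koszul_sign_def single_uminus[symmetric] algebra_simps)
  qed (auto simp: nsv.scale_right_distrib nsv.scale_left_commute simp del: nsv.scale_scale)
qed (auto simp: nsv.scale_right_distrib nsv.scale_left_commute simp del: nsv.scale_scale)

lemma single_1: "Poly_Mapping.single b (c::complex) = ns_scale c (Poly_Mapping.single b 1)"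
  by simp

lemma bracket_single': "bracket NS (Poly_Mapping.single b s) (Poly_Mapping.single c t)
   = ns_scale (s * t) (ns_basis_bracket b c)"
  by (subst (1 2) single_1) (simp only: bracket_simps bracket_single nsv.scale_scale mult.commute)

lemma bracket_jacobi:
  assumes "\<forall>b\<in>Poly_Mapping.keys x. ns_parity b = i" "\<forall>b\<in>Poly_Mapping.keys y. ns_parity b = j"
  shows "bracket NS x (bracket NS y z) =
     bracket NS (bracket NS x y) z + ns_scale (koszul_sign i j) (bracket NS y (bracket NS x z))"
  using assms(1)
proof (induction x rule: ns_induct)
  case (single b)
  from assms(2) show ?case
  proof (induction y rule: ns_induct)
    case (single c)
    show ?case
    proof (induction z rule: ns_induct_UNIV)
      case (single d)
      show ?case using \<open>ns_parity b = i\<close> \<open>ns_parity c = j\<close>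
        by (cases b; cases c; cases d; intro poly_mapping_eqI;
            simp add: bracket_single' koszul_sign_def half_def lookup_add lookup_single when_def
              add.assoc add.left_commute[of _ _ "_ :: int"] add.commute[of _ "_ :: int"];
            intro impI; simp add: field_simps)
    qed (auto simp: nsv.scale_right_distrib nsv.scale_left_commute algebra_simps simp del: nsv.scale_scale)
  qed (auto simp: nsv.scale_right_distrib nsv.scale_left_commute algebra_simps simp del: nsv.scale_scale)
qed (auto simp: nsv.scale_right_distrib nsv.scale_left_commute algebra_simps simp del: nsv.scale_scale)

theorem lie_superalgebra_NS: "lie_superalgebra NS"
  unfolding lie_superalgebra_def NS_simps(1)
  by (intro conjI allI ballI super_vector_space_NS linear_bracket bracket_part bracket_skew bracket_jacobi;
      simp)


section \<open>The modules \<open>\<Omega>\<close> are supermodules\<close>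

lemma poly_shift [simp]: "poly (shift c f) x = poly f (c + x)"
  by (simp add: shift_def poly_pcompose)

interpretation pv: vector_space pair_scale by (rule vector_space_pair)

lemma pair_scale_simps [simp]:
  "fst (pair_scale c v) = smult c (fst v)" "snd (pair_scale c v) = smult c (snd v)"
  by (simp_all add: pair_scale_def)

lemma shift_add [simp]: "shift c (f + g) = shift c f + shift c g"
  and shift_smult [simp]: "shift c (smult d f) = smult d (shift c f)"
  and shift_0 [simp]: "shift c 0 = 0"
  by (simp_all add: shift_def pcompose_add pcompose_smult)

lemma linear_Omega_basis_act:
  "Vector_Spaces.linear pair_scale pair_scale (Omega_basis_act lam \<alpha> b)"
  unfolding Vector_Spaces.linear_iff
  by (cases b) (auto simp: vector_space_pair pair_scale_def smult_add_right algebra_simps)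

lemma linear_act_Omega:
  "Vector_Spaces.linear pair_scale pair_scale (\<lambda>v. act (Omega_NS lam \<alpha>) x v)"
  "Vector_Spaces.linear ns_scale pair_scale (\<lambda>x. act (Omega_NS lam \<alpha>) x v)"
  using linear_ns_extend_coeff[OF vector_space_pair vector_space_pair linear_Omega_basis_act]
    linear_ns_extend[OF vector_space_pair]
  by (simp_all add: Omega_NS_def)

lemmas act_simps [simp] = ns_linear_simps[OF linear_act_Omega(1)] ns_linear_simps[OF linear_act_Omega(2)]

lemma act_single [simp]:
  "act (Omega_NS lam \<alpha>) (Poly_Mapping.single b c) v = pair_scale c (Omega_basis_act lam \<alpha> b v)"
  by (simp add: Omega_NS_def vector_space_pair)

lemma Omega_simps [simp]:
  "scale (Omega_NS lam \<alpha>) = pair_scale"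
  "v \<in> part (Omega_NS lam \<alpha>) i \<longleftrightarrow> (if i = 0 then snd v = 0 else fst v = 0)"
  by (simp_all add: Omega_NS_def)

lemma subspace_part_Omega: "pv.subspace (part (Omega_NS lam \<alpha>) i)"
  by (rule pv.subspaceI) (auto split: if_splits)

lemma super_vector_space_Omega: "super_vector_space (Omega_NS lam \<alpha>)"
proof -
  have "\<exists>u\<in>part (Omega_NS lam \<alpha>) 0. \<exists>w\<in>part (Omega_NS lam \<alpha>) 1. v = u + w" for v
    by (intro bexI[of _ "(fst v, 0)"] bexI[of _ "(0, snd v)"]) auto
  moreover have "part (Omega_NS lam \<alpha>) 0 \<inter> part (Omega_NS lam \<alpha>) 1 = {0}"
    by (auto simp: prod_eq_iff)
  ultimately show ?thesis
    unfolding super_vector_space_def by (simp add: vector_space_pair subspace_part_Omega del: Omega_simps(2))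
qed

lemma act_part:
  assumes "\<forall>b\<in>Poly_Mapping.keys x. ns_parity b = i" "v \<in> part (Omega_NS lam \<alpha>) j"
  shows "act (Omega_NS lam \<alpha>) x v \<in> part (Omega_NS lam \<alpha>) (i + j)"
  using assms(1)
proof (induction x rule: ns_induct)
  case (single b)
  then show ?case using assms(2)
    by (cases v; cases b; cases i; cases j) auto
qed (auto simp del: Omega_simps(2) intro!: pv.subspace_0 pv.subspace_add pv.subspace_scale subspace_part_Omega)

lemma act_bracket:
  assumes "lam \<noteq> 0"
    and "\<forall>b\<in>Poly_Mapping.keys x. ns_parity b = i" "\<forall>b\<in>Poly_Mapping.keys y. ns_parity b = j"
  shows "act (Omega_NS lam \<alpha>) (bracket NS x y) v =
     act (Omega_NS lam \<alpha>) x (act (Omega_NS lam \<alpha>) y v)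
       - pair_scale (koszul_sign i j) (act (Omega_NS lam \<alpha>) y (act (Omega_NS lam \<alpha>) x v))"
  using assms(2)
proof (induction x rule: ns_induct)
  case (single b)
  from assms(3) show ?case
  proof (induction y rule: ns_induct)
    case (single c)
    obtain f g where v: "v = (f, g)" by (cases v)
    note poly_eqI' = iffD1[OF poly_eq_poly_eq_iff, OF ext]
    show ?case using \<open>ns_parity b = i\<close> \<open>ns_parity c = j\<close> assms(1)
      by (cases b; cases c; intro prod_eqI poly_eqI';
          simp add: v bracket_single koszul_sign_def half_def power_int_add ac_simps;
          simp add: field_simps)
  next
    case (scale e y)
    then show ?case
      by (simp add: ns_linear_simps[OF linear_Omega_basis_act] pv.scale_right_diff_distrib
          pv.scale_left_commute del: pv.scale_scale)
  qed (auto simp: pv.scale_right_distrib algebra_simps ns_linear_simps[OF linear_Omega_basis_act])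
next
  case (scale e x)
  then show ?case
    by (simp add: pv.scale_right_diff_distrib pv.scale_left_commute del: pv.scale_scale)
qed (auto simp: pv.scale_right_distrib algebra_simps)

theorem supermodule_Omega:
  assumes "lam \<noteq> 0"
  shows "supermodule NS (Omega_NS lam \<alpha>)"
  unfolding supermodule_def NS_simps(1) Omega_simps(1)
  by (intro conjI allI ballI lie_superalgebra_NS super_vector_space_Omega linear_act_Omega act_part
      act_bracket assms; simp only: NS_simps)

end

theory Submission
  imports Defs
begin

text \<open>An isomorphism commutes with \<open>L\<^sub>0\<close>, which multiplies by \<open>x\<close> on the even part; so there it is
  multiplication by the image \<open>p\<close> of \<open>1\<close>, and \<open>p\<close> is a nonzero constant by surjectivity. Comparing the
  images of \<open>L\<^sub>1 1 = \<lambda>(x + \<alpha>)\<close> then gives \<open>\<lambda> = \<mu>\<close> and \<open>\<alpha> = \<beta>\<close>.\<close>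

lemma shift_zero [simp]: "shift 0 f = f"
  by (simp add: shift_def pcompose_idR)

lemma shift_const [simp]: "shift c [:a:] = [:a:]" and shift_one [simp]: "shift c 1 = 1"
  by (simp_all add: shift_def pcompose_1)

text \<open>The even part is free of rank one over the polynomials in \<open>L 0\<close>, with
  generator 1, so the image of 1 determines the map there.\<close>

lemma Omega_morphism_even:
  assumes lin: "Vector_Spaces.linear pair_scale pair_scale \<phi>"
    and comm: "\<And>x v. \<phi> (act (Omega_NS lam \<alpha>) x v) = act (Omega_NS mu \<beta>) x (\<phi> v)"
    and one: "\<phi> (1, 0) = (p, 0)"
  shows "\<phi> (f, 0) = (p * f, 0)"
proof (induction f)
  case 0
  then show ?case using ns_linear_simps(1)[OF lin] by (simp add: zero_prod_def)
next
  case (pCons a f)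
  \<comment> \<open>At index 0 the factor \<open>lam powi m\<close>, the term with \<alpha> and the
    shift all disappear, in source and target alike: \<open>L 0\<close> sends \<open>(f, 0)\<close>
    to \<open>(pCons 0 f, 0)\<close>.\<close>
  have "\<phi> (pCons 0 f, 0) = (pCons 0 (p * f), 0)"
    using comm[of "Poly_Mapping.single (L 0) 1" "(f, 0)"] pCons
    by (simp add: pair_scale_def)
  moreover have "\<phi> ([:a:], 0) = (smult a p, 0)"
    using ns_linear_simps(3)[OF lin, of a "(1, 0)"] one by (simp add: pair_scale_def)
  moreover have "(pCons a f, 0) = (pCons 0 f, 0) + ([:a:], 0 :: complex poly)"
    by simp
  ultimately show ?case
    using ns_linear_simps(2)[OF lin, of "(pCons 0 f, 0)" "([:a:], 0)"]
    by (simp add: mult_pCons_right add.commute)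
qed

lemma Omega_isomorphism_imp_eq:
  assumes "lam \<noteq> 0"
    and iso: "supermodule_isomorphism (Omega_NS lam \<alpha>) (Omega_NS mu \<beta>) \<phi>"
  shows "lam = mu \<and> \<alpha> = \<beta>"
proof -
  have lin: "Vector_Spaces.linear pair_scale pair_scale \<phi>"
    and bij: "bij \<phi>"
    and parity: "\<And>i v. v \<in> part (Omega_NS lam \<alpha>) i \<Longrightarrow> \<phi> v \<in> part (Omega_NS mu \<beta>) i"
    and comm: "\<And>x v. \<phi> (act (Omega_NS lam \<alpha>) x v) = act (Omega_NS mu \<beta>) x (\<phi> v)"
    using iso unfolding supermodule_isomorphism_def by (auto simp del: Omega_simps(2) simp: image_subset_iff)
  obtain p where one: "\<phi> (1, 0) = (p, 0)"
    using parity[of "(1, 0)" 0] by (cases "\<phi> (1, 0)") auto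
  note even = Omega_morphism_even[OF lin comm one]
  \<comment> \<open>The preimage may have an odd component \<open>g\<close>, but by parity its image
    does not reach the first coordinate, which therefore reads \<open>p * f = 1\<close>.\<close>
  obtain f g where fg: "\<phi> (f, g) = (1, 0)"
    using bij by (metis bij_pointE surj_pair)
  have "fst (\<phi> (0, g)) = 0"
    using parity[of "(0, g)" 1] by simp
  moreover have "\<phi> (f, g) = \<phi> (f, 0) + \<phi> (0, g)"
    using ns_linear_simps(2)[OF lin, of "(f, 0)" "(0, g)"] by simp
  ultimately have "p * f = 1"
    using fg even by (simp add: prod_eq_iff)
  then have "is_unit p" by (metis dvd_triv_left)
  then obtain c where p: "p = [:c:]" and "c \<noteq> 0"
    unfolding is_unit_poly_iff by fastforce
  \<comment> \<open>Both sides come from \<open>L 1\<close>, applied to 1 before \<phi> and to the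
    constant \<open>c\<close> after it; shifts fix constants.\<close>
  have "\<phi> (smult lam [:\<alpha>, 1:], 0) = (smult (mu * c) [:\<beta>, 1:], 0)"
    using comm[of "Poly_Mapping.single (L 1) 1" "(1, 0)"]
    by (simp add: one p pair_scale_def mult.assoc)
  then have "[:c * (lam * \<alpha>), c * lam:] = [:c * (mu * \<beta>), c * mu:]"
    by (simp add: even p ac_simps)
  then have "lam * \<alpha> = mu * \<beta>" and "lam = mu"
    using \<open>c \<noteq> 0\<close> by auto
  then show ?thesis using assms(1) by simp
qed

theorem theorem2p14:
  fixes lam mu \<alpha> \<beta> :: complex
  assumes "lam \<noteq> 0" and "mu \<noteq> 0"
  shows "supermodule_isomorphic NS (Omega_NS lam \<alpha>) (Omega_NS mu \<beta>) \<longleftrightarrow> lam = mu \<and> \<alpha> = \<beta>"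
proof
  assume "supermodule_isomorphic NS (Omega_NS lam \<alpha>) (Omega_NS mu \<beta>)"
  then show "lam = mu \<and> \<alpha> = \<beta>"
    using Omega_isomorphism_imp_eq[OF assms(1)] unfolding supermodule_isomorphic_def by blast
next
  assume eq: "lam = mu \<and> \<alpha> = \<beta>"
  have "supermodule_isomorphism (Omega_NS lam \<alpha>) (Omega_NS lam \<alpha>) (\<lambda>v. v)"
    unfolding supermodule_isomorphism_def Vector_Spaces.linear_iff
    by (simp add: vector_space_pair bij_id[unfolded id_def])
  \<comment> \<open>Being isomorphic includes that both sides are supermodules, which rests on
    \<open>lam\<close> being nonzero.\<close>
  then show "supermodule_isomorphic NS (Omega_NS lam \<alpha>) (Omega_NS mu \<beta>)"
    unfolding supermodule_isomorphic_def using eq supermodule_Omega[OF assms(1)] by blast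
qed

end
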